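(* Let $0<b<a$ and $c=\sqrt{a^2-b^2}$. For $\lambda<b^2$ let $$\mathcal{E}_\lambda:\ \frac{x^2}{a^2-\lambda}+\frac{y^2}{b^2-\lambda}-1=0,$$ and put $\delta_2=\sqrt{4a^2-b^2-3\lambda}$, $$X_{3,\lambda}=\left[0,\,-\frac{c\,\delta_2}{\sqrt{b^2-\lambda}}\right],\qquad R_\lambda=\frac{2(a^2-\lambda)}{\sqrt{b^2-\lambda}}.$$ Then the family of triangles circumscribing $\mathcal{E}_\lambda$ and inscribed in the circle of radius $R_\lambda$ centered on $X_{3,\lambda}$ has fixed Brocard points on the foci $[\pm c,0]$ of $\mathcal{E}_\lambda$. Moreover, varying $\lambda\in(-\infty,b^2)$ covers the entire 2d (two-parameter) family of triangles with Brocard points on $[\pm c,0]$.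
   Context: A triangle circumscribes an ellipse if its three sides are tangent to the ellipse. The Brocard points of a triangle with counterclockwise vertices $P_1,P_2,P_3$ are the points $\Omega_1,\Omega_2$ with $\angle\Omega_1P_1P_2=\angle\Omega_1P_2P_3=\angle\Omega_1P_3P_1=\omega$ and $\angle\Omega_2P_2P_1=\angle\Omega_2P_3P_2=\angle\Omega_2P_1P_3=\omega$, where $\omega$ is the Brocard angle of the triangle. The ellipses $\mathcal{E}_\lambda$ are origin-centered and confocal, with common foci $[\pm c,0]$.
   Formalization: "Brocard points on [±c,0]" is taken with the first Brocard point at [-c,0] and the second at [c,0]; with the roles exchanged the triangles are mirror images in the x-axis, whose circumcenter has positive ordinate, so the family does not cover them. *)

theory Defs
  imports "HOL-Analysis.Analysis"
begin

type_synonym point = "real \<times> real"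

type_synonym triangle = "point \<times> point \<times> point"

definition ccw_triangle :: "point \<Rightarrow> point \<Rightarrow> point \<Rightarrow> bool" where
  "ccw_triangle P1 P2 P3 \<longleftrightarrow>
     (fst P2 - fst P1) * (snd P3 - snd P1) - (snd P2 - snd P1) * (fst P3 - fst P1) > 0"

text \<open>The unsigned angle at the vertex \<open>Q\<close>, in \<open>[0, \<pi>]\<close> (and \<open>\<pi>/2\<close> by convention if
  \<open>P = Q\<close> or \<open>R = Q\<close>).\<close>

definition angle :: "point \<Rightarrow> point \<Rightarrow> point \<Rightarrow> real" where
  "angle P Q R = arccos (((P - Q) \<bullet> (R - Q)) / (norm (P - Q) * norm (R - Q)))"

text \<open>The Brocard angle \<open>\<omega>\<close> is given by
  \<open>cot \<omega> = cot \<alpha> + cot \<beta> + cot \<gamma>\<close> with \<open>0 < \<omega> < \<pi>\<close>,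
  where \<open>\<alpha>\<close>, \<open>\<beta>\<close>, \<open>\<gamma>\<close> are the interior angles; the inverse cotangent
  with values in \<open>(0, \<pi>)\<close> is \<open>\<pi>/2 - arctan\<close>.\<close>

definition brocard_angle :: "point \<Rightarrow> point \<Rightarrow> point \<Rightarrow> real" where
  "brocard_angle P1 P2 P3 =
     pi / 2 - arctan (cot (angle P3 P1 P2) + cot (angle P1 P2 P3) + cot (angle P2 P3 P1))"

text \<open>The common value of the three angles is required to be the Brocard angle: the three
  unsigned angles can also coincide, with a different value, for some points outside the triangle.\<close>

definition first_brocard_point :: "point \<Rightarrow> point \<Rightarrow> point \<Rightarrow> point \<Rightarrow> bool" where
  "first_brocard_point W P1 P2 P3 \<longleftrightarrow>
     angle W P1 P2 = brocard_angle P1 P2 P3 \<and>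
     angle W P2 P3 = brocard_angle P1 P2 P3 \<and>
     angle W P3 P1 = brocard_angle P1 P2 P3"

definition second_brocard_point :: "point \<Rightarrow> point \<Rightarrow> point \<Rightarrow> point \<Rightarrow> bool" where
  "second_brocard_point W P1 P2 P3 \<longleftrightarrow>
     angle W P2 P1 = brocard_angle P1 P2 P3 \<and>
     angle W P3 P2 = brocard_angle P1 P2 P3 \<and>
     angle W P1 P3 = brocard_angle P1 P2 P3"

definition confocal_ellipse :: "real \<Rightarrow> real \<Rightarrow> real \<Rightarrow> point set" where
  "confocal_ellipse a b l = {(x, y). x\<^sup>2 / (a\<^sup>2 - l) + y\<^sup>2 / (b\<^sup>2 - l) - 1 = 0}"

text \<open>The line \<open>PQ\<close> is tangent to the ellipse \<open>E\<close>, i.e. meets it in exactly one point,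
  and the point of contact lies on the side \<open>PQ\<close> itself.\<close>

definition side_tangent :: "point \<Rightarrow> point \<Rightarrow> point set \<Rightarrow> bool" where
  "side_tangent P Q E \<longleftrightarrow> (\<exists>T \<in> closed_segment P Q. affine hull {P, Q} \<inter> E = {T})"

definition circumscribes :: "point \<Rightarrow> point \<Rightarrow> point \<Rightarrow> point set \<Rightarrow> bool" where
  "circumscribes P1 P2 P3 E \<longleftrightarrow>
     side_tangent P1 P2 E \<and> side_tangent P2 P3 E \<and> side_tangent P3 P1 E"

definition delta2 :: "real \<Rightarrow> real \<Rightarrow> real \<Rightarrow> real" where
  "delta2 a b l = sqrt (4 * a\<^sup>2 - b\<^sup>2 - 3 * l)"

definition X3 :: "real \<Rightarrow> real \<Rightarrow> real \<Rightarrow> point" where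
  "X3 a b l = (0, - (sqrt (a\<^sup>2 - b\<^sup>2) * delta2 a b l / sqrt (b\<^sup>2 - l)))"

definition circ_radius :: "real \<Rightarrow> real \<Rightarrow> real \<Rightarrow> real" where
  "circ_radius a b l = 2 * (a\<^sup>2 - l) / sqrt (b\<^sup>2 - l)"

definition circ_circle :: "real \<Rightarrow> real \<Rightarrow> real \<Rightarrow> point set" where
  "circ_circle a b l = sphere (X3 a b l) (circ_radius a b l)"

definition poncelet_family :: "real \<Rightarrow> real \<Rightarrow> real \<Rightarrow> triangle set" where
  "poncelet_family a b l =
     {(P1, P2, P3). ccw_triangle P1 P2 P3 \<and>
        circumscribes P1 P2 P3 (confocal_ellipse a b l) \<and>
        P1 \<in> circ_circle a b l \<and> P2 \<in> circ_circle a b l \<and> P3 \<in> circ_circle a b l}"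

text \<open>The two Brocard points are distinguished: exchanging \<open>W1\<close> and \<open>W2\<close> gives the
  mirror images of these triangles in the line \<open>W1 W2\<close>.\<close>

definition brocard_triangles :: "point \<Rightarrow> point \<Rightarrow> triangle set" where
  "brocard_triangles W1 W2 =
     {(P1, P2, P3). ccw_triangle P1 P2 P3 \<and>
        first_brocard_point W1 P1 P2 P3 \<and> second_brocard_point W2 P1 P2 P3}"

end

theory Submission
  imports Defs
begin

text \<open>
  Write \<open>A = a\<^sup>2 - l\<close> and \<open>B = b\<^sup>2 - l\<close> for the squared semi-axes, \<open>F1 = (-c, 0)\<close> and \<open>F2 = (c, 0)\<close> for the foci, and
  let \<open>\<omega>\<close> be the acute angle with \<open>4 sin\<^sup>2 \<omega> = B / A\<close>, \<open>k = cot \<omega>\<close>. Three facts carry the proof.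

  A line is tangent to the ellipse iff the product of its signed distances from the foci is \<open>B\<close>. For a point
  \<open>P\<close> of the given circle this quadratic condition on the direction of a line through \<open>P\<close>
  splits into two linear ones: the tangents from \<open>P\<close> are the line \<open>P F1\<close> turned clockwise by \<open>\<omega>\<close> and the line
  \<open>P F2\<close> turned counterclockwise by \<open>\<omega>\<close> (\<open>foci_mult_factorization\<close>). So in a
  triangle of the family the sides make the angle \<open>\<omega>\<close> with the rays to the foci, in the way that Brocard points
  require; orientation and position of the points of contact leave only one choice of the two tangents
  for each side (\<open>tangent_chord_imp_turns\<close>).

  Unsigned angles are enough to characterize Brocard points. If \<open>x\<close> denotes the signed area that a point \<open>W\<close> spans
  with a side, and \<open>m\<close> the inner product of this side with the vector from its initial vertex to \<open>W\<close>, then both the sum of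
  the \<open>x\<close> and the sum of the \<open>m\<close> are independent of \<open>W\<close>, and the ratio of the sums is the cotangent of the Brocard angle. Hence
  \<open>m = k \<bar>x\<bar>\<close> for the three sides with this particular \<open>k\<close> forces all \<open>x\<close> to be positive (\<open>proportional_abs_iff\<close>), and
  conversely \<open>m = k x\<close> for any \<open>k\<close> forces \<open>k\<close> to be the cotangent of the Brocard angle (\<open>turns_imp_brocard_cot\<close>).

  Going from \<open>P\<close> along the first of the two tangents to the second intersection with the circle is a
  Moebius transformation of the circle. Its third iterate is the identity iff \<open>(1 + k\<^sup>2) B = 4 A\<close>,
  which is the choice of \<open>\<omega>\<close> above (\<open>chord_chord_imp\<close>). This yields the unique triangle of the family at each
  point of the circle. Conversely, let a triangle have its Brocard points at the foci. At each vertex the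
  factorization gives the product of the focal distances of both adjacent sides, so
  this product is the same number \<open>B\<close> for all three sides, which are therefore tangent to one confocal ellipse, and
  the vertices lie on one circle. Since three chords close up, \<open>(1 + k\<^sup>2) B = 4 A\<close> holds, and
  the circle is the given one for \<open>l = b\<^sup>2 - B\<close> (\<open>turns_imp_brocard_porism\<close>).
\<close>

section \<open>Angles in terms of inner and cross products\<close>

definition cross :: "point \<Rightarrow> point \<Rightarrow> real" where
  "cross u v = fst u * snd v - snd u * fst v"

text \<open>The ray \<open>PR\<close> lies counterclockwise from the ray \<open>PQ\<close> at an angle with cotangent
  \<open>k\<close>. Cleared of denominators, this condition is polynomial in the coordinates.\<close>

definition turn :: "real \<Rightarrow> point \<Rightarrow> point \<Rightarrow> point \<Rightarrow> bool" where
  "turn k P Q R \<longleftrightarrow> 0 < cross (Q - P) (R - P) \<and>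
     (Q - P) \<bullet> (R - P) = k * cross (Q - P) (R - P)"

lemma cross_commute: "cross u v = - cross v u"
  by (simp add: cross_def)

lemma inner_sq_plus_cross_sq: "(u \<bullet> v)\<^sup>2 + (cross u v)\<^sup>2 = (norm u)\<^sup>2 * (norm v)\<^sup>2"
  by (simp add: cross_def inner_prod_def norm_prod_def power2_eq_square algebra_simps)

lemma angle_eq_arctan:
  assumes "cross (P - Q) (R - Q) \<noteq> 0"
  shows "angle P Q R = pi / 2 - arctan ((P - Q) \<bullet> (R - Q) / \<bar>cross (P - Q) (R - Q)\<bar>)"
proof -
  define m x where "m = (P - Q) \<bullet> (R - Q)" and "x = \<bar>cross (P - Q) (R - Q)\<bar>"
  have x: "x > 0" using assms by (simp add: x_def)
  have "norm (P - Q) * norm (R - Q) = sqrt (m\<^sup>2 + x\<^sup>2)"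
    unfolding m_def x_def power2_abs inner_sq_plus_cross_sq by (simp add: real_sqrt_mult)
  also have "m\<^sup>2 + x\<^sup>2 = x\<^sup>2 * (1 + (m / x)\<^sup>2)"
    using x by (simp add: field_simps)
  finally have n: "norm (P - Q) * norm (R - Q) = x * sqrt (1 + (m / x)\<^sup>2)"
    using x by (simp add: real_sqrt_mult)
  have "angle P Q R = arccos (sin (arctan (m / x)))"
    unfolding angle_def m_def[symmetric] n sin_arctan by (simp add: field_simps)
  also have "\<dots> = arccos (cos (pi / 2 - arctan (m / x)))"
    by (simp add: cos_diff)
  also have "\<dots> = pi / 2 - arctan (m / x)"
    using arctan_bounded[of "m / x"] by (intro arccos_cos) auto
  finally show ?thesis by (simp add: m_def x_def)
qed

text \<open>An equality of an unsigned angle with an acute one rules out degenerate positions, since these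
  only produce the three values below.\<close>

lemma angle_degenerate:
  assumes "cross (P - Q) (R - Q) = 0"
  shows "angle P Q R \<in> {0, pi / 2, pi}"
proof -
  have "((P - Q) \<bullet> (R - Q))\<^sup>2 = (norm (P - Q) * norm (R - Q))\<^sup>2"
    using inner_sq_plus_cross_sq[of "P - Q" "R - Q"] assms by (simp add: power_mult_distrib)
  then have "(P - Q) \<bullet> (R - Q) = norm (P - Q) * norm (R - Q) \<or>
      (P - Q) \<bullet> (R - Q) = - (norm (P - Q) * norm (R - Q))"
    by (simp add: power2_eq_iff)
  then have "((P - Q) \<bullet> (R - Q)) / (norm (P - Q) * norm (R - Q)) \<in> {0, 1, -1}"
    by auto
  moreover have "arccos r \<in> {0, pi / 2, pi}" if "r \<in> {0, 1, -1}" for r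
    using that by auto
  ultimately show ?thesis unfolding angle_def by blast
qed

lemma cot_complement_arctan: "cot (pi / 2 - arctan t) = t"
proof -
  have "cot (pi / 2 - arctan t) = tan (arctan t)"
    by (simp add: cot_def tan_def cos_diff sin_diff)
  then show ?thesis by (simp add: tan_arctan)
qed

section \<open>Brocard points as solutions of polynomial equations\<close>

definition brocard_cot :: "point \<Rightarrow> point \<Rightarrow> point \<Rightarrow> real" where
  "brocard_cot P1 P2 P3 =
     ((norm (P2 - P1))\<^sup>2 + (norm (P3 - P2))\<^sup>2 + (norm (P1 - P3))\<^sup>2) / (2 * cross (P2 - P1) (P3 - P1))"

lemma ccw_iff_cross: "ccw_triangle P1 P2 P3 \<longleftrightarrow> 0 < cross (P2 - P1) (P3 - P1)"
  by (simp add: ccw_triangle_def cross_def)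

lemma brocard_cot_pos:
  assumes "ccw_triangle P1 P2 P3"
  shows "0 < brocard_cot P1 P2 P3"
proof -
  have "P2 \<noteq> P1" using assms by (auto simp: ccw_triangle_def)
  then show ?thesis
    using assms unfolding brocard_cot_def ccw_iff_cross
    by (intro divide_pos_pos add_pos_nonneg) auto
qed

text \<open>The cotangent of an interior angle is the inner product of the two sides divided by twice the area, and the three inner products
  add up to half the sum of the squared sides.\<close>

lemma brocard_angle_eq:
  assumes "ccw_triangle P1 P2 P3"
  shows "brocard_angle P1 P2 P3 = pi / 2 - arctan (brocard_cot P1 P2 P3)"
proof -
  define D where "D = cross (P2 - P1) (P3 - P1)"
  have D: "0 < D" using assms by (simp add: ccw_iff_cross D_def)
  have c1: "cross (P3 - P1) (P2 - P1) = - D" and c2: "cross (P1 - P2) (P3 - P2) = - D"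
    and c3: "cross (P2 - P3) (P1 - P3) = - D"
    by (simp_all add: D_def cross_def algebra_simps)
  have "cot (angle P3 P1 P2) = (P3 - P1) \<bullet> (P2 - P1) / D"
    "cot (angle P1 P2 P3) = (P1 - P2) \<bullet> (P3 - P2) / D"
    "cot (angle P2 P3 P1) = (P2 - P3) \<bullet> (P1 - P3) / D"
    using D by (simp_all add: angle_eq_arctan cot_complement_arctan c1 c2 c3)
  then have "cot (angle P3 P1 P2) + cot (angle P1 P2 P3) + cot (angle P2 P3 P1)
      = ((P3 - P1) \<bullet> (P2 - P1) + (P1 - P2) \<bullet> (P3 - P2) + (P2 - P3) \<bullet> (P1 - P3)) / D"
    by (simp add: add_divide_distrib)
  also have "\<dots> = brocard_cot P1 P2 P3"
    using D unfolding brocard_cot_def D_def[symmetric] power2_norm_eq_inner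
    by (simp add: field_simps inner_prod_def)
  finally show ?thesis by (simp add: brocard_angle_def)
qed

lemma angle_eq_complement_arctan_iff:
  assumes "0 < k"
  shows "angle P Q R = pi / 2 - arctan k \<longleftrightarrow>
    cross (P - Q) (R - Q) \<noteq> 0 \<and> (P - Q) \<bullet> (R - Q) = k * \<bar>cross (P - Q) (R - Q)\<bar>"
proof (cases "cross (P - Q) (R - Q) = 0")
  case True
  have "0 < arctan k" "arctan k < pi / 2" using assms arctan_ubound by auto
  then have "0 < pi / 2 - arctan k \<and> pi / 2 - arctan k < pi / 2"
    by simp
  then have "pi / 2 - arctan k \<notin> {0, pi / 2, pi}"
    using pi_gt_zero by (intro notI) (elim insertE emptyE; linarith)
  then show ?thesis using True angle_degenerate[OF True] by metis
next
  case False
  then show ?thesis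
    by (simp add: angle_eq_arctan arctan_eq_iff divide_eq_eq)
qed

text \<open>This is what makes unsigned angles suffice. A point that sees the three sides under the same unsigned
  angle may lie outside the triangle, with some of the signed areas \<open>x\<close> negative. If the common angle is the
  Brocard angle, then \<open>\<Sum>\<bar>x\<bar> = \<Sum>x\<close>, so all areas are nonnegative.\<close>

lemma proportional_abs_iff:
  fixes k :: real
  assumes "0 < k" and "m1 + m2 + m3 = k * (x1 + x2 + x3)"
  shows "(x1 \<noteq> 0 \<and> m1 = k * \<bar>x1\<bar>) \<and> (x2 \<noteq> 0 \<and> m2 = k * \<bar>x2\<bar>) \<and> (x3 \<noteq> 0 \<and> m3 = k * \<bar>x3\<bar>) \<longleftrightarrow>
    (0 < x1 \<and> m1 = k * x1) \<and> (0 < x2 \<and> m2 = k * x2) \<and> (0 < x3 \<and> m3 = k * x3)"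
    (is "?L \<longleftrightarrow> ?R")
proof
  assume L: ?L
  then have "k * (\<bar>x1\<bar> + \<bar>x2\<bar> + \<bar>x3\<bar>) = k * (x1 + x2 + x3)"
    using assms(2) by (simp add: distrib_left)
  then have "\<bar>x1\<bar> + \<bar>x2\<bar> + \<bar>x3\<bar> = x1 + x2 + x3"
    using assms(1) by simp
  then have "0 \<le> x1 \<and> 0 \<le> x2 \<and> 0 \<le> x3" by linarith
  then show ?R using L by simp
qed auto

text \<open>The areas that a point spans with the three sides add up to the area of the triangle, and
  the corresponding inner products also have a sum that does not depend on the point.\<close>

lemma sum_inner_cross_first:
  "(P2 - P1) \<bullet> (W - P1) + (P3 - P2) \<bullet> (W - P2) + (P1 - P3) \<bullet> (W - P3)
     = ((norm (P2 - P1))\<^sup>2 + (norm (P3 - P2))\<^sup>2 + (norm (P1 - P3))\<^sup>2) / 2"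
  "cross (P2 - P1) (W - P1) + cross (P3 - P2) (W - P2) + cross (P1 - P3) (W - P3)
     = cross (P2 - P1) (P3 - P1)"
  by (simp_all add: power2_norm_eq_inner inner_prod_def cross_def field_simps)

lemma sum_inner_cross_second:
  "(W - P2) \<bullet> (P1 - P2) + (W - P3) \<bullet> (P2 - P3) + (W - P1) \<bullet> (P3 - P1)
     = ((norm (P2 - P1))\<^sup>2 + (norm (P3 - P2))\<^sup>2 + (norm (P1 - P3))\<^sup>2) / 2"
  "cross (W - P2) (P1 - P2) + cross (W - P3) (P2 - P3) + cross (W - P1) (P3 - P1)
     = cross (P2 - P1) (P3 - P1)"
  by (simp_all add: power2_norm_eq_inner inner_prod_def cross_def field_simps)

lemma proportionality_constant_eq_brocard_cot:
  assumes "ccw_triangle P1 P2 P3"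
    and "m1 + m2 + m3 = ((norm (P2 - P1))\<^sup>2 + (norm (P3 - P2))\<^sup>2 + (norm (P1 - P3))\<^sup>2) / 2"
    and "x1 + x2 + x3 = cross (P2 - P1) (P3 - P1)"
  shows "m1 + m2 + m3 = k * (x1 + x2 + x3) \<longleftrightarrow> k = brocard_cot P1 P2 P3"
  using assms by (auto simp: ccw_iff_cross brocard_cot_def field_simps)

text \<open>Here a Brocard point becomes a solution of polynomial equations: the three cotangents are
  equal, and their common value is \<open>k\<close>.\<close>

lemma first_brocard_point_iff:
  assumes "ccw_triangle P1 P2 P3"
  shows "first_brocard_point W P1 P2 P3 \<longleftrightarrow>
    (let k = brocard_cot P1 P2 P3 in turn k P1 P2 W \<and> turn k P2 P3 W \<and> turn k P3 P1 W)"
proof -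
  define k where "k = brocard_cot P1 P2 P3"
  have k: "0 < k" unfolding k_def using assms by (rule brocard_cot_pos)
  have swap: "cross (W - P) (Q - P) \<noteq> 0 \<and> (W - P) \<bullet> (Q - P) = k * \<bar>cross (W - P) (Q - P)\<bar> \<longleftrightarrow>
      cross (Q - P) (W - P) \<noteq> 0 \<and> (Q - P) \<bullet> (W - P) = k * \<bar>cross (Q - P) (W - P)\<bar>" for P Q
    by (simp add: cross_commute[of "W - P"] inner_commute)
  show ?thesis
    unfolding first_brocard_point_def brocard_angle_eq[OF assms] k_def[symmetric] Let_def turn_def
      angle_eq_complement_arctan_iff[OF k] swap
    by (rule proportional_abs_iff[OF k])
      (use proportionality_constant_eq_brocard_cot[OF assms sum_inner_cross_first] k_def in blast)
qed

lemma second_brocard_point_iff: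
  assumes "ccw_triangle P1 P2 P3"
  shows "second_brocard_point W P1 P2 P3 \<longleftrightarrow>
    (let k = brocard_cot P1 P2 P3 in turn k P2 W P1 \<and> turn k P3 W P2 \<and> turn k P1 W P3)"
proof -
  define k where "k = brocard_cot P1 P2 P3"
  have k: "0 < k" unfolding k_def using assms by (rule brocard_cot_pos)
  show ?thesis
    unfolding second_brocard_point_def brocard_angle_eq[OF assms] k_def[symmetric] Let_def turn_def
      angle_eq_complement_arctan_iff[OF k]
    by (rule proportional_abs_iff[OF k])
      (use proportionality_constant_eq_brocard_cot[OF assms sum_inner_cross_second] k_def in blast)
qed

text \<open>Summing the three equations shows that equal turns at the three vertices can only be turns by the
  Brocard angle, so the angle never has to be computed separately.\<close>

lemma turns_imp_brocard_cot:
  assumes "ccw_triangle P1 P2 P3" and "turn k P1 P2 W" "turn k P2 P3 W" "turn k P3 P1 W"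
  shows "k = brocard_cot P1 P2 P3"
proof -
  have "(P2 - P1) \<bullet> (W - P1) + (P3 - P2) \<bullet> (W - P2) + (P1 - P3) \<bullet> (W - P3)
    = k * (cross (P2 - P1) (W - P1) + cross (P3 - P2) (W - P2) + cross (P1 - P3) (W - P3))"
    using assms by (simp add: turn_def distrib_left)
  then show ?thesis
    using proportionality_constant_eq_brocard_cot[OF assms(1) sum_inner_cross_first] by blast
qed

section \<open>Tangents of an ellipse in terms of its foci\<close>

locale focal_pair =
  fixes c :: real
  assumes c_pos: "0 < c"
begin

abbreviation F1 :: point where "F1 \<equiv> (- c, 0)"

abbreviation F2 :: point where "F2 \<equiv> (c, 0)"

end

text \<open>\<open>A\<close> and \<open>B\<close> are the squared semi-axes of the ellipse, and \<open>(\<plusminus>c, 0)\<close> are its foci.\<close>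

locale confocal_ellipse_parameters = focal_pair c for c :: real +
  fixes a b l A B :: real
  assumes B_pos: "0 < B" and A_eq: "A = B + c\<^sup>2"
    and A_l: "a\<^sup>2 - l = A" and B_l: "b\<^sup>2 - l = B"
begin

abbreviation E :: "point set" where "E \<equiv> confocal_ellipse a b l"

lemma A_pos: "0 < A"
  using B_pos c_pos by (simp add: A_eq add_pos_pos)

lemma mem_E: "p \<in> E \<longleftrightarrow> B * (fst p)\<^sup>2 + A * (snd p)\<^sup>2 = A * B"
  using A_pos B_pos
  by (cases p) (auto simp: confocal_ellipse_def A_l B_l field_simps)

text \<open>For a unit vector \<open>v\<close>, the square of half the width of the ellipse orthogonal to \<open>v\<close>. A line of
  direction \<open>v\<close> through \<open>P\<close> is tangent iff \<open>(cross v (- P))\<^sup>2 = width v\<close>.\<close>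

definition width :: "point \<Rightarrow> real" where
  "width v = B * (fst v)\<^sup>2 + A * (snd v)\<^sup>2"

lemma width_pos: "v \<noteq> 0 \<Longrightarrow> 0 < width v"
  using A_pos B_pos unfolding width_def
  by (cases v) (auto simp: zero_prod_def intro: add_pos_nonneg add_nonneg_pos)

text \<open>By this identity, a line is tangent iff the product of its signed distances from the two foci is \<open>B\<close>.
  In this form tangency can be compared with angles at the foci.\<close>

lemma cross_foci_mult:
  "cross v (F1 - P) * cross v (F2 - P) = B * (norm v)\<^sup>2 + ((cross v (- P))\<^sup>2 - width v)"
  by (simp add: cross_def width_def power2_norm_eq_inner inner_prod_def) (use A_eq in algebra)

lemma cross_foci_add: "cross v (F1 - P) + cross v (F2 - P) = 2 * cross v (- P)"
  by (simp add: cross_def algebra_simps)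

text \<open>The equation of the ellipse on the line, with the square completed; the right-hand side is a quarter of the discriminant.\<close>

lemma on_line_mem_E:
  assumes "v \<noteq> 0"
  shows "P + s *\<^sub>R v \<in> E \<longleftrightarrow>
    (width v * s + (B * fst P * fst v + A * snd P * snd v))\<^sup>2 = A * B * (width v - (cross v (- P))\<^sup>2)"
    (is "_ \<longleftrightarrow> ?q = ?r")
proof -
  obtain x y where P: "P = (x, y)" by (cases P)
  obtain p q where v: "v = (p, q)" by (cases v)
  have "?q - ?r = width v * (B * (x + s * p)\<^sup>2 + A * (y + s * q)\<^sup>2 - A * B)"
    unfolding P v by (simp add: width_def cross_def power2_eq_square) algebra
  then have "?q = ?r \<longleftrightarrow> B * (x + s * p)\<^sup>2 + A * (y + s * q)\<^sup>2 - A * B = 0"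
    using width_pos[OF assms] by (metis eq_iff_diff_eq_0 mult_eq_0_iff less_irrefl)
  then show ?thesis by (simp add: mem_E P v)
qed

lemma affine_hull_2_eq: "affine hull {P, Q} = range (\<lambda>s. P + s *\<^sub>R (Q - P))" for P Q :: point
proof (intro equalityI subsetI)
  fix T assume "T \<in> affine hull {P, Q}"
  then obtain u w where "u + w = 1" and T: "T = u *\<^sub>R P + w *\<^sub>R Q"
    unfolding affine_hull_2 by blast
  then have u: "u = 1 - w" by simp
  have "T = P + w *\<^sub>R (Q - P)" unfolding T u by (simp add: algebra_simps)
  then show "T \<in> range (\<lambda>s. P + s *\<^sub>R (Q - P))" by blast
next
  fix T assume "T \<in> range (\<lambda>s. P + s *\<^sub>R (Q - P))"
  then obtain s where "T = P + s *\<^sub>R (Q - P)" by blast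
  then have "T = (1 - s) *\<^sub>R P + s *\<^sub>R Q" by (simp add: algebra_simps)
  moreover have "(1 - s) + s = 1" by simp
  ultimately show "T \<in> affine hull {P, Q}" unfolding affine_hull_2 by blast
qed

lemma side_tangent_imp_contact:
  assumes "side_tangent P Q E" and "P \<noteq> Q"
  obtains t where "0 \<le> t" "t \<le> 1" "P + t *\<^sub>R (Q - P) \<in> E" "affine hull {P, Q} \<inter> E = {P + t *\<^sub>R (Q - P)}"
    and "(cross (Q - P) (- P))\<^sup>2 = width (Q - P)"
proof -
  obtain T where T: "T \<in> closed_segment P Q" "affine hull {P, Q} \<inter> E = {T}"
    using assms(1) by (auto simp: side_tangent_def)
  obtain t where t: "0 \<le> t" "t \<le> 1" and Tt: "T = P + t *\<^sub>R (Q - P)"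
    using T(1) by (auto simp: in_segment algebra_simps)
  define v where "v = Q - P"
  have v: "v \<noteq> 0" using assms(2) by (simp add: v_def)
  define \<beta> where "\<beta> = B * fst P * fst v + A * snd P * snd v"
  define r where "r = A * B * (width v - (cross v (- P))\<^sup>2)"
  have iff: "P + s *\<^sub>R v \<in> E \<longleftrightarrow> (width v * s + \<beta>)\<^sup>2 = r" for s
    using on_line_mem_E[OF v] unfolding \<beta>_def r_def .
  have TE: "P + t *\<^sub>R v \<in> E" using T(2) Tt by (auto simp: v_def)
  \<comment> \<open>The quadratic equation for \<open>s\<close> has the root \<open>s'\<close> besides \<open>t\<close>, so \<open>s' = t\<close>.\<close>
  define s' where "s' = - 2 * \<beta> / width v - t"
  have s': "width v * s' + \<beta> = - (width v * t + \<beta>)"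
    using width_pos[OF v] by (simp add: s'_def field_simps)
  have "P + s' *\<^sub>R v \<in> E" using TE unfolding iff s' power2_minus .
  then have "P + s' *\<^sub>R v = P + t *\<^sub>R v"
    using T(2) unfolding affine_hull_2_eq Tt v_def[symmetric] by blast
  then have "s' = t" using v by simp
  from s'[unfolded this] have "width v * t + \<beta> = 0" by linarith
  then have "r = 0" using TE iff by simp
  then have "(cross v (- P))\<^sup>2 = width v" using A_pos B_pos by (simp add: r_def)
  then show ?thesis
    using that[OF t] TE T(2) unfolding Tt v_def by simp
qed

lemma side_tangent_imp_foci_mult:
  assumes "side_tangent P Q E" and "P \<noteq> Q"
  shows "cross (Q - P) (F1 - P) * cross (Q - P) (F2 - P) = B * (norm (Q - P))\<^sup>2"
proof -
  have "(cross (Q - P) (- P))\<^sup>2 = width (Q - P)"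
    by (rule side_tangent_imp_contact[OF assms])
  then show ?thesis by (simp add: cross_foci_mult)
qed

text \<open>The ellipse does not leave the strip between its two tangents of direction \<open>v\<close>.\<close>

lemma cross_sq_le_width:
  assumes "T \<in> E"
  shows "(cross v T)\<^sup>2 \<le> width v"
proof -
  have "A * B * (cross v T)\<^sup>2 + (B * fst v * fst T + A * snd v * snd T)\<^sup>2
      = width v * (B * (fst T)\<^sup>2 + A * (snd T)\<^sup>2)"
    by (simp add: cross_def width_def) algebra
  then have "A * B * (cross v T)\<^sup>2 \<le> A * B * width v"
    using assms zero_le_power2[of "B * fst v * fst T + A * snd v * snd T"]
    unfolding mem_E by (simp only: mult.commute[of "width v"])
  then show ?thesis using A_pos B_pos by simp
qed

text \<open>If the ellipse were on the outer side of \<open>P1 P2\<close>, then the points of contact with the two other sides, which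
  lie in the closed triangle, would have to be on the line \<open>P1 P2\<close>. They would then be the vertices \<open>P2\<close> and \<open>P1\<close>,
  two distinct points of the ellipse on a tangent.\<close>

lemma circumscribes_imp_left_of_side:
  assumes ccw: "ccw_triangle P1 P2 P3" and circ: "circumscribes P1 P2 P3 E"
  shows "0 < cross (P2 - P1) (- P1)"
proof (rule ccontr)
  assume neg: "\<not> 0 < cross (P2 - P1) (- P1)"
  define D where "D = cross (P2 - P1) (P3 - P1)"
  have D: "0 < D" using ccw by (simp add: ccw_iff_cross D_def)
  have ne: "P1 \<noteq> P2" "P2 \<noteq> P3" "P3 \<noteq> P1"
    using ccw by (auto simp: ccw_triangle_def)
  have side: "side_tangent P1 P2 E" "side_tangent P2 P3 E" "side_tangent P3 P1 E"
    using circ by (simp_all add: circumscribes_def)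
  obtain t1 where t1: "affine hull {P1, P2} \<inter> E = {P1 + t1 *\<^sub>R (P2 - P1)}"
    "(cross (P2 - P1) (- P1))\<^sup>2 = width (P2 - P1)"
    by (rule side_tangent_imp_contact[OF side(1) ne(1)]) (rule that)
  obtain t2 where t2: "0 \<le> t2" "P2 + t2 *\<^sub>R (P3 - P2) \<in> E"
    by (rule side_tangent_imp_contact[OF side(2) ne(2)]) (rule that)
  obtain t3 where t3: "t3 \<le> 1" "P3 + t3 *\<^sub>R (P1 - P3) \<in> E"
    by (rule side_tangent_imp_contact[OF side(3) ne(3)]) (rule that)
  have right: "cross (P2 - P1) (T - P1) \<le> 0" if "T \<in> E" for T
  proof -
    have "\<bar>cross (P2 - P1) T\<bar> \<le> \<bar>cross (P2 - P1) (- P1)\<bar>"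
      using cross_sq_le_width[OF that] t1(2) by (simp add: abs_le_square_iff)
    moreover have "cross (P2 - P1) (T - P1) = cross (P2 - P1) T + cross (P2 - P1) (- P1)"
      by (simp add: cross_def algebra_simps)
    ultimately show ?thesis using neg by linarith
  qed
  have "cross (P2 - P1) (P2 + t2 *\<^sub>R (P3 - P2) - P1) = t2 * D"
    by (simp add: D_def cross_def algebra_simps)
  then have "t2 * D \<le> 0" using right[OF t2(2)] by simp
  then have "t2 = 0" using t2(1) D by (simp add: mult_le_0_iff)
  then have P2: "P2 \<in> E" using t2 by simp
  have "cross (P2 - P1) (P3 + t3 *\<^sub>R (P1 - P3) - P1) = (1 - t3) * D"
    by (simp add: D_def cross_def algebra_simps)
  then have "(1 - t3) * D \<le> 0" using right[OF t3(2)] by simp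
  then have "t3 = 1" using t3(1) D by (simp add: mult_le_0_iff)
  then have P1: "P1 \<in> E" using t3 by simp
  have "P1 \<in> affine hull {P1, P2}" "P2 \<in> affine hull {P1, P2}"
    by (auto intro: hull_inc)
  then show False using P1 P2 t1(1) ne(1) by (metis IntI singletonD)
qed

lemma circumscribes_imp_foci_left_of_side:
  assumes "ccw_triangle P1 P2 P3" and "circumscribes P1 P2 P3 E"
  shows "cross (P2 - P1) (F1 - P1) * cross (P2 - P1) (F2 - P1) = B * (norm (P2 - P1))\<^sup>2"
    and "0 < cross (P2 - P1) (F1 - P1)" and "0 < cross (P2 - P1) (F2 - P1)"
proof -
  have ne: "P1 \<noteq> P2"
    using assms(1) by (auto simp: ccw_triangle_def)
  show eq: "cross (P2 - P1) (F1 - P1) * cross (P2 - P1) (F2 - P1) = B * (norm (P2 - P1))\<^sup>2"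
    using assms(2) ne by (intro side_tangent_imp_foci_mult) (auto simp: circumscribes_def)
  then have "0 < cross (P2 - P1) (F1 - P1) * cross (P2 - P1) (F2 - P1)"
    using B_pos ne by simp
  moreover have "0 < cross (P2 - P1) (F1 - P1) + cross (P2 - P1) (F2 - P1)"
    using circumscribes_imp_left_of_side[OF assms] by (simp add: cross_foci_add)
  ultimately show "0 < cross (P2 - P1) (F1 - P1)" "0 < cross (P2 - P1) (F2 - P1)"
    by (auto simp: zero_less_mult_iff)
qed

lemma eq_by_inner_and_cross:
  assumes "v \<noteq> 0" and "v \<bullet> p = v \<bullet> q" and "cross v p = cross v q"
  shows "p = (q :: point)"
proof -
  have "(norm v)\<^sup>2 * (norm (p - q))\<^sup>2 = (v \<bullet> (p - q))\<^sup>2 + (cross v (p - q))\<^sup>2"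
    by (rule inner_sq_plus_cross_sq[symmetric])
  also have "\<dots> = 0"
    using assms by (simp add: inner_diff_right cross_def algebra_simps)
  finally show ?thesis using assms(1) by simp
qed

text \<open>The feet of the perpendiculars from \<open>F1\<close> and \<open>F2\<close> have distances from \<open>P\<close> and
  from \<open>Q\<close>, respectively, that are \<open>k\<close> times their lengths. By the reflection property, the point of contact
  divides the segment between the feet in the ratio of these lengths, and therefore it divides \<open>PQ\<close> in the same ratio:
  it is \<open>P + (x / (x + y)) (Q - P)\<close> with \<open>x\<close> and \<open>y\<close> proportional to the distances of the foci, and
  so it lies on the side itself.\<close>

lemma turns_imp_side_tangent:
  assumes "turn k P Q F1" and "turn k Q F2 P"
    and eq: "cross (Q - P) (F1 - P) * cross (Q - P) (F2 - P) = B * (norm (Q - P))\<^sup>2"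
  shows "side_tangent P Q E"
proof -
  define v x y where "v = Q - P" and "x = cross v (F1 - P)" and "y = cross v (F2 - P)"
  have x: "0 < x" and ix: "v \<bullet> (F1 - P) = k * x"
    using assms(1) by (simp_all add: turn_def v_def x_def)
  have "y = cross (F2 - Q) (P - Q)" by (simp add: y_def v_def cross_def algebra_simps)
  then have y: "0 < y" and iy: "v \<bullet> (Q - F2) = k * y"
    using assms(2) by (simp_all add: turn_def v_def inner_prod_def algebra_simps)
  have v: "v \<noteq> 0" using x by (auto simp: x_def cross_def)
  have xy: "x + y = 2 * cross v (- P)" by (simp add: x_def y_def cross_foci_add)
  have \<kappa>: "(cross v (- P))\<^sup>2 = width v"
    using eq cross_foci_mult[of v P] by (simp add: v_def)
  \<comment> \<open>The right-hand side is the pole of the line \<open>PQ\<close>, scaled by \<open>x + y\<close>.\<close>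
  have pole: "(x + y) *\<^sub>R P + x *\<^sub>R v = (2 * A * snd v, - 2 * B * fst v)" (is "?p = ?q")
  proof (rule eq_by_inner_and_cross[OF v])
    have "y * (v \<bullet> (F1 - P)) = x * (v \<bullet> (Q - F2))" by (simp add: ix iy)
    then have "v \<bullet> ?p = x * (v \<bullet> F2) + y * (v \<bullet> F1)"
      by (simp add: v_def inner_diff_right inner_add_right algebra_simps)
    also have "\<dots> = (x - y) * c * fst v" by (simp add: inner_prod_def algebra_simps)
    also have "x - y = 2 * c * snd v" by (simp add: x_def y_def cross_def algebra_simps)
    finally show "v \<bullet> ?p = v \<bullet> ?q"
      by (simp add: inner_prod_def A_eq algebra_simps power2_eq_square)
    have "cross v ?p = - (x + y) * cross v (- P)"
      by (simp add: cross_def algebra_simps)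
    also have "\<dots> = - 2 * width v" unfolding xy \<kappa>[symmetric] by (simp add: power2_eq_square)
    finally show "cross v ?p = cross v ?q"
      by (simp add: cross_def width_def power2_eq_square)
  qed
  define t where "t = x / (x + y)"
  have t: "0 \<le> t" "t \<le> 1" using x y by (simp_all add: t_def)
  have T: "P + t *\<^sub>R v = (A * snd v / cross v (- P), - B * fst v / cross v (- P))"
  proof -
    have "(x + y) *\<^sub>R (P + t *\<^sub>R v) = ?p" using x y by (simp add: t_def scaleR_add_right)
    then have "P + t *\<^sub>R v = (1 / (x + y)) *\<^sub>R ?q" using x y pole
      by (metis add_pos_pos divideR_right inverse_eq_divide less_irrefl)
    then show ?thesis unfolding xy by simp
  qed
  have pos: "cross v (- P) > 0" using x y xy by simp
  have "B * (A * snd v)\<^sup>2 + A * (B * fst v)\<^sup>2 = A * B * (cross v (- P))\<^sup>2"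
    unfolding \<kappa> width_def by algebra
  then have TE: "P + t *\<^sub>R v \<in> E" unfolding mem_E T
    using pos by (simp add: power_divide flip: add_divide_distrib)
  have "s = t" if "P + s *\<^sub>R v \<in> E" for s
  proof -
    have "width v * r + (B * fst P * fst v + A * snd P * snd v) = 0" if "P + r *\<^sub>R v \<in> E" for r
      using that unfolding on_line_mem_E[OF v] \<kappa> by simp
    from this[OF TE] this[OF that] have "width v * s = width v * t" by linarith
    then show ?thesis using width_pos[OF v] by simp
  qed
  then have "affine hull {P, Q} \<inter> E = {P + t *\<^sub>R v}"
    using TE unfolding affine_hull_2_eq v_def[symmetric] by blast
  moreover have "P + t *\<^sub>R v \<in> closed_segment P Q"
    using t by (auto simp: in_segment v_def algebra_simps)
  ultimately show ?thesis unfolding side_tangent_def by blast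
qed

end

section \<open>Lines at a fixed angle to the focal rays\<close>

text \<open>The number \<open>k\<close> is the cotangent of the angle between the sides of a triangle and the rays from its vertices to the foci.\<close>

locale focal_pencil = focal_pair c for c :: real +
  fixes k :: real
  assumes k_pos: "0 < k"
begin

text \<open>Its level sets are the circles centered on \<open>(0, - c k)\<close>, the point from which the segment between the foci is
  seen under twice the angle with cotangent \<open>k\<close>.\<close>

definition pencil :: "point \<Rightarrow> real" where
  "pencil P = (norm P)\<^sup>2 - c\<^sup>2 + 2 * c * k * snd P"

lemma pencil_eq: "pencil P = (fst P)\<^sup>2 + (snd P)\<^sup>2 - c\<^sup>2 + 2 * c * k * snd P"
  by (simp add: pencil_def norm_prod_def)

text \<open>On a level set \<open>pencil P = (1 + k\<^sup>2) B\<close> the left-hand side vanishes exactly for the directions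
  \<open>v\<close> of the tangents from \<open>P\<close> to the confocal ellipse whose squared minor semi-axis is \<open>B\<close>. The factors on the right say that these two tangents arise from the
  lines to the foci by a rotation about \<open>P\<close>: clockwise for \<open>F1\<close>, counterclockwise for \<open>F2\<close>, both
  through the angle with cotangent \<open>k\<close>.\<close>

lemma foci_mult_factorization:
  "(1 + k\<^sup>2) * (cross v (F1 - P) * cross v (F2 - P)) - (norm v)\<^sup>2 * pencil P
     = - ((v \<bullet> (F1 - P) - k * cross v (F1 - P)) * (v \<bullet> (F2 - P) + k * cross v (F2 - P)))"
  unfolding pencil_eq power2_norm_eq_inner inner_prod_def cross_def inner_real_def
    fst_diff snd_diff fst_conv snd_conv
  by algebra

lemma foci_mult_eq_imp_inner:
  assumes "(1 + k\<^sup>2) * (cross v (F1 - P) * cross v (F2 - P)) = (norm v)\<^sup>2 * pencil P"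
  shows "v \<bullet> (F1 - P) = k * cross v (F1 - P) \<or> v \<bullet> (F2 - P) = - (k * cross v (F2 - P))"
proof -
  have "(v \<bullet> (F1 - P) - k * cross v (F1 - P)) * (v \<bullet> (F2 - P) + k * cross v (F2 - P)) = 0"
    using foci_mult_factorization[of v P] assms by linarith
  then show ?thesis unfolding mult_eq_0_iff right_minus_eq eq_neg_iff_add_eq_0 .
qed

lemma turn_first_imp_foci_mult:
  assumes "turn k P Q F1"
  shows "(1 + k\<^sup>2) * (cross (Q - P) (F1 - P) * cross (Q - P) (F2 - P)) = (norm (Q - P))\<^sup>2 * pencil P"
  using foci_mult_factorization[of "Q - P" P] assms by (simp add: turn_def)

lemma turn_second_imp_foci_mult:
  assumes "turn k Q F2 P"
  shows "(1 + k\<^sup>2) * (cross (Q - P) (F1 - P) * cross (Q - P) (F2 - P)) = (norm (Q - P))\<^sup>2 * pencil Q"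
proof -
  have "(P - Q) \<bullet> (F2 - Q) + k * cross (P - Q) (F2 - Q) = 0"
    using assms by (simp add: turn_def inner_commute cross_commute[of "P - Q"])
  moreover have "cross (P - Q) (F1 - Q) * cross (P - Q) (F2 - Q) = cross (Q - P) (F1 - P) * cross (Q - P) (F2 - P)"
    by (simp add: cross_def algebra_simps)
  ultimately show ?thesis
    using foci_mult_factorization[of "P - Q" Q] by (simp add: norm_minus_commute)
qed

section \<open>Chords of a circle at a fixed angle to a focal ray\<close>

text \<open>Complex coordinates around the common center \<open>(0, - c k)\<close> of the circles.\<close>

definition to_complex :: "point \<Rightarrow> complex" where
  "to_complex P = Complex (fst P) (snd P + c * k)"

lemma inj_to_complex: "to_complex P = to_complex Q \<longleftrightarrow> P = Q"
  by (auto simp: to_complex_def prod_eq_iff)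

lemma norm_to_complex: "(cmod (to_complex P))\<^sup>2 = pencil P + c\<^sup>2 * (1 + k\<^sup>2)"
  unfolding to_complex_def pencil_eq cmod_power2 complex.sel by algebra

text \<open>For \<open>p\<close> and \<open>q\<close> on the circle of squared radius \<open>(1 + k\<^sup>2) A\<close>, this says that the chord \<open>pq\<close>
  makes at \<open>p\<close> the angle with cotangent \<open>k\<close> with the line to the first focus (\<open>chord_iff\<close>). Solved for \<open>q\<close>, it is a
  Moebius transformation of \<open>p\<close>: conjugates on the circle are rational.\<close>

definition chord :: "real \<Rightarrow> complex \<Rightarrow> complex \<Rightarrow> bool" where
  "chord A p q \<longleftrightarrow>
     of_real A * (of_real k + \<i>) * q + of_real A * (of_real k - \<i>) * p + \<i> * of_real c * p * q
       = \<i> * of_real (c * (1 + k\<^sup>2) * A)"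

text \<open>The coefficient of \<open>q\<close> vanishes only for \<open>p\<close> off the circle, because \<open>c\<^sup>2 < A\<close>
  puts the pole of the Moebius transformation outside the circle.\<close>

lemma chord_unique_right:
  assumes "c\<^sup>2 < A" and "(cmod p)\<^sup>2 = (1 + k\<^sup>2) * A"
    and "chord A p q" and "chord A p q'"
  shows "q = q'"
proof -
  have A: "0 < A" using assms(1) by (smt (verit) zero_le_power2)
  \<comment> \<open>The coefficient of \<open>q\<close> in the chord relation.\<close>
  define d where "d = of_real A * (of_real k + \<i>) + \<i> * of_real c * p"
  have "d * q = d * q'"
    using assms(3,4) unfolding chord_def d_def by algebra
  moreover have "d \<noteq> 0"
  proof
    assume "d = 0"
    then have "of_real A * (of_real k + \<i>) = - (\<i> * of_real c * p)"
      unfolding d_def by (simp add: eq_neg_iff_add_eq_0)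
    then have "(cmod (of_real A * (of_real k + \<i>)))\<^sup>2 = (cmod (- (\<i> * of_real c * p)))\<^sup>2" by simp
    moreover have "(cmod (of_real k + \<i>))\<^sup>2 = 1 + k\<^sup>2" by (simp add: cmod_power2)
    ultimately have "A\<^sup>2 * (1 + k\<^sup>2) = c\<^sup>2 * ((1 + k\<^sup>2) * A)"
      by (simp add: norm_mult power_mult_distrib assms(2))
    then have "A * ((1 + k\<^sup>2) * (A - c\<^sup>2)) = 0" by (simp add: power2_eq_square algebra_simps)
    moreover have "1 + k\<^sup>2 \<noteq> 0" by (smt (verit) zero_le_power2)
    ultimately show False using A assms(1) by simp
  qed
  ultimately show ?thesis by simp
qed

text \<open>Reflection in the \<open>y\<close>-axis exchanges the foci and reverses the orientation, so a chord seen from one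
  end under the given angle with the first focus is mapped to one seen in this way from its other end.\<close>

lemma chord_reflect: "chord A (- cnj q) (- cnj p) \<longleftrightarrow> chord A p q"
proof -
  have "chord A p q \<longleftrightarrow>
      cnj (of_real A * (of_real k + \<i>) * q + of_real A * (of_real k - \<i>) * p + \<i> * of_real c * p * q)
        = cnj (\<i> * of_real (c * (1 + k\<^sup>2) * A))"
    unfolding chord_def complex_cnj_cancel_iff ..
  also have "\<dots> \<longleftrightarrow> chord A (- cnj q) (- cnj p)"
    unfolding chord_def by (simp add: algebra_simps) (metis (no_types, lifting) ac_simps)
  finally show ?thesis by simp
qed

lemma chord_unique_left:
  assumes "c\<^sup>2 < A" and "(cmod p)\<^sup>2 = (1 + k\<^sup>2) * A"
    and "chord A q p" and "chord A q' p"
  shows "q = q'"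
proof -
  have "- cnj q = - cnj q'"
    using assms(2-4) by (intro chord_unique_right[OF assms(1), of "- cnj p"]) (simp_all add: chord_reflect)
  then show ?thesis by simp
qed

text \<open>Two steps of the Moebius transformation lead from \<open>p\<close> to \<open>r\<close>; the bracket on the left vanishes iff a third step
  leads back. The right-hand side shows that, for \<open>r \<noteq> p\<close>, closure after three steps is a condition on the parameters only.
  It is used in both directions: to close the triangle, and to read off the parameters from a given triangle.\<close>

lemma chord_chord_imp:
  assumes "chord A p q" and "chord A q r"
  shows "2 * \<i> * of_real A * (of_real A * (of_real k + \<i>) * p + of_real A * (of_real k - \<i>) * r + \<i> * of_real c * r * p
      - \<i> * of_real (c * (1 + k\<^sup>2) * A))
    = (p - r) * of_real (A * (A * (k\<^sup>2 - 3) - c\<^sup>2 * (1 + k\<^sup>2)))"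
proof -
  have i: "\<i> * \<i> = -1" by simp
  show ?thesis
  using assms i unfolding chord_def of_real_mult of_real_add of_real_diff of_real_power of_real_1 of_real_numeral 
  by algebra
qed

lemma chord_not_symmetric:
  assumes "A \<noteq> 0" "chord A p q" and "chord A q p"
  shows "p = q"
proof -
  have "2 * \<i> * of_real A * (q - p) = 0"
    using assms(2,3) unfolding chord_def by algebra
  then show ?thesis using assms(1) by simp
qed

text \<open>The condition on the right says that \<open>cnj (q - p) * e\<close> is real, where \<open>e\<close> is the direction from \<open>P\<close> to the
  first focus, turned clockwise. On the circle, conjugates are inverses up to a constant, and then this
  becomes the polynomial relation \<open>chord\<close>.\<close>

lemma chord_iff:
  assumes P: "pencil P + c\<^sup>2 * (1 + k\<^sup>2) = (1 + k\<^sup>2) * A" and Q: "pencil Q + c\<^sup>2 * (1 + k\<^sup>2) = (1 + k\<^sup>2) * A"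
    and "A \<noteq> 0" and "P \<noteq> Q"
  shows "chord A (to_complex P) (to_complex Q) \<longleftrightarrow>
    (Q - P) \<bullet> (F1 - P) = k * cross (Q - P) (F1 - P)"
proof -
  define p q where "p = to_complex P" and "q = to_complex Q"
  define e where "e = \<i> * of_real (c * (1 + k\<^sup>2)) - p * (of_real k - \<i>)"
  define L where "L = of_real A * (of_real k + \<i>) * q + of_real A * (of_real k - \<i>) * p + \<i> * of_real c * p * q
       - \<i> * of_real (c * (1 + k\<^sup>2) * A)"
  define \<tau> where "\<tau> = (Q - P) \<bullet> (F1 - P) - k * cross (Q - P) (F1 - P)"
  have pos: "1 + k\<^sup>2 \<noteq> 0" by (smt (verit) zero_le_power2)
  have pp: "p * cnj p = of_real ((1 + k\<^sup>2) * A)" and qq: "q * cnj q = of_real ((1 + k\<^sup>2) * A)"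
    unfolding complex_norm_square[symmetric] p_def q_def of_real_power[symmetric] norm_to_complex P Q by simp_all
  have "p * cnj p \<noteq> 0" "q * cnj q \<noteq> 0"
    unfolding pp qq of_real_eq_0_iff using pos \<open>A \<noteq> 0\<close> by simp_all
  then have nz: "p \<noteq> 0" "q \<noteq> 0" by auto
  have ne: "p \<noteq> q" using \<open>P \<noteq> Q\<close> by (simp add: p_def q_def inj_to_complex)
  have im: "Im (cnj (q - p) * e) = - \<tau>"
    by (simp add: p_def q_def e_def \<tau>_def to_complex_def cross_def inner_prod_def power2_eq_square algebra_simps)
  have "cnj (q - p) * e - (q - p) * cnj e = 2 * \<i> * of_real (Im (cnj (q - p) * e))"
    by (simp add: complex_eq_iff algebra_simps)
  then have "p * q * (2 * \<i> * of_real (- \<tau>)) = p * q * (cnj (q - p) * e - (q - p) * cnj e)"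
    unfolding im by (simp only:)
  also have "\<dots> = of_real (1 + k\<^sup>2) * ((q - p) * L)"
  proof -
    have e': "cnj e = - \<i> * of_real (c * (1 + k\<^sup>2)) - cnj p * (of_real k + \<i>)"
      by (simp add: e_def)
    have i: "\<i> * \<i> = -1" by simp
    show ?thesis using pp qq i unfolding complex_cnj_diff e'
      unfolding L_def e_def of_real_mult of_real_add of_real_power of_real_1
      by algebra
  qed
  finally have "\<tau> = 0 \<longleftrightarrow> L = 0"
    using nz ne pos by (metis (no_types, lifting) complex_i_not_zero divisors_zero mult_zero_right neg_equal_0_iff_equal
      of_real_eq_0_iff right_minus_eq zero_neq_numeral of_real_0 mult_zero_left minus_zero)
  then show ?thesis unfolding chord_def p_def[symmetric] q_def[symmetric] \<tau>_def L_def by simp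
qed

end

section \<open>The porism\<close>

text \<open>With \<open>k = cot \<omega>\<close> the assumption reads \<open>4 sin\<^sup>2 \<omega> = B / A\<close>. It is the parameter condition
  for closure after three chords, and the given circle is then the level set \<open>(1 + k\<^sup>2) B\<close> of \<open>pencil\<close>.\<close>

locale brocard_porism = confocal_ellipse_parameters c a b l A B + focal_pencil c k
  for c a b l A B k :: real +
  assumes closure: "(1 + k\<^sup>2) * B = 4 * A"
begin

lemma one_plus_k_sq_pos: "0 < 1 + k\<^sup>2"
  by (simp add: add_pos_nonneg)

lemma c_sq_less_A: "c\<^sup>2 < A"
  using B_pos by (simp add: A_eq)

lemma mem_circle: "P \<in> circ_circle a b l \<longleftrightarrow> pencil P = (1 + k\<^sup>2) * B"
proof -
  have c: "sqrt (a\<^sup>2 - b\<^sup>2) = c"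
    using A_l B_l A_eq c_pos by (intro real_sqrt_unique) auto
  have "k\<^sup>2 = (4 * A - B) / B"
    using closure B_pos by (simp add: field_simps)
  moreover have "4 * a\<^sup>2 - b\<^sup>2 - 3 * l = 4 * A - B"
    using A_l B_l by linarith
  ultimately have "delta2 a b l / sqrt B = sqrt (k\<^sup>2)"
    by (simp add: delta2_def real_sqrt_divide)
  then have k: "delta2 a b l / sqrt B = k" using k_pos by simp
  have X: "X3 a b l = (0, - (c * k))"
    unfolding X3_def c B_l k[symmetric] by simp
  have r: "(2 * A / sqrt B)\<^sup>2 = (1 + k\<^sup>2) * A"
  proof -
    have "(2 * A / sqrt B)\<^sup>2 = (4 * A) * A / B"
      using B_pos by (simp add: power_divide power2_eq_square)
    then show ?thesis unfolding closure[symmetric] using B_pos by simp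
  qed
  have "P \<in> circ_circle a b l \<longleftrightarrow> dist (X3 a b l) P = 2 * A / sqrt B"
    by (simp add: circ_circle_def circ_radius_def A_l B_l)
  also have "\<dots> \<longleftrightarrow> (dist (X3 a b l) P)\<^sup>2 = (2 * A / sqrt B)\<^sup>2"
    using A_pos B_pos by (intro power2_eq_iff_nonneg[symmetric]) auto
  also have "(dist (X3 a b l) P)\<^sup>2 = pencil P + c\<^sup>2 * (1 + k\<^sup>2)"
    unfolding X pencil_eq dist_norm power2_norm_eq_inner inner_prod_def inner_real_def
      fst_diff snd_diff fst_conv snd_conv by algebra
  finally show ?thesis unfolding r by (simp add: A_eq algebra_simps)
qed

text \<open>The bound is the squared radius against the squared height \<open>k A / c\<close>; the difference is positive because
  \<open>k\<^sup>2 B = 4 A - B > 4 c\<^sup>2\<close>.\<close>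

lemma circle_height_less:
  assumes "pencil P = (1 + k\<^sup>2) * B"
  shows "c * (snd P + c * k) < k * A"
proof (rule power2_less_imp_less)
  have "(fst P)\<^sup>2 + (snd P + c * k)\<^sup>2 = (1 + k\<^sup>2) * A"
    using assms unfolding pencil_eq by (simp add: A_eq power2_eq_square algebra_simps)
  then have "(snd P + c * k)\<^sup>2 \<le> (1 + k\<^sup>2) * A"
    by (metis le_add_same_cancel2 zero_le_power2)
  then have "(c * (snd P + c * k))\<^sup>2 \<le> c\<^sup>2 * ((1 + k\<^sup>2) * A)"
    by (simp add: power_mult_distrib mult_left_mono)
  also have "\<dots> < (k * A)\<^sup>2"
  proof -
    have "4 * c\<^sup>2 < k\<^sup>2 * B" using closure B_pos unfolding A_eq by (simp add: algebra_simps)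
    then have "4 * c\<^sup>2 * A\<^sup>2 < k\<^sup>2 * B * A\<^sup>2" using A_pos by simp
    moreover have "4 * c\<^sup>2 * A\<^sup>2 = B * (c\<^sup>2 * ((1 + k\<^sup>2) * A))" using closure by algebra
    ultimately have "B * (c\<^sup>2 * ((1 + k\<^sup>2) * A)) < B * (k * A)\<^sup>2"
      by (simp only: power_mult_distrib ac_simps)
    then show ?thesis using B_pos by simp
  qed
  finally show "(c * (snd P + c * k))\<^sup>2 < (k * A)\<^sup>2" .
  show "0 \<le> k * A" using k_pos A_pos by simp
qed

text \<open>The chord condition only fixes the line \<open>PQ\<close>. That \<open>Q\<close> lies on the correct ray comes from this
  formula together with \<open>circle_height_less\<close>: the circle meets the line again only in that direction.\<close>

lemma cross_first_of_chord:
  assumes "pencil P = (1 + k\<^sup>2) * B" "pencil Q = (1 + k\<^sup>2) * B" "P \<noteq> Q"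
    and "(Q - P) \<bullet> (F1 - P) = k * cross (Q - P) (F1 - P)"
  shows "cross (Q - P) (F1 - P) = 2 * (k * A - c * (snd P + c * k))"
proof -
  obtain x y where P: "P = (x, y)" by (cases P)
  obtain p q where v: "Q - P = (p, q)" by (cases "Q - P")
  have Q: "Q = (x + p, y + q)" using v P by (metis add.commute add_Pair diff_add_cancel)
  \<comment> \<open>\<open>X\<close> is the left-hand side in coordinates.\<close>
  define X where "X = p * (- y) - q * (- c - x)"
  have h: "x\<^sup>2 + (y + c * k)\<^sup>2 = (1 + k\<^sup>2) * A" "p\<^sup>2 + q\<^sup>2 + 2 * (p * x + q * (y + c * k)) = 0"
    "p * (- c - x) + q * (- y) = k * X"
    using assms unfolding pencil_eq P Q X_def
    by (simp_all add: A_eq cross_def inner_prod_def power2_eq_square algebra_simps)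
  have "(1 + k\<^sup>2) * (p\<^sup>2 + q\<^sup>2) * (X - 2 * (k * A - c * (y + c * k))) = 0"
    using h X_def by algebra
  moreover have "p\<^sup>2 + q\<^sup>2 \<noteq> 0" using v assms(3) by (auto simp: sum_power2_eq_zero_iff zero_prod_def[symmetric])
  ultimately have "X = 2 * (k * A - c * (y + c * k))"
    using one_plus_k_sq_pos by (metis eq_iff_diff_eq_0 less_irrefl mult_eq_0_iff)
  then show ?thesis unfolding v by (simp add: P X_def cross_def)
qed

lemma turn_first_of_chord:
  assumes "pencil P = (1 + k\<^sup>2) * B" "pencil Q = (1 + k\<^sup>2) * B" "P \<noteq> Q"
    and "(Q - P) \<bullet> (F1 - P) = k * cross (Q - P) (F1 - P)"
  shows "turn k P Q F1"
  using assms cross_first_of_chord[OF assms] circle_height_less[OF assms(1)] by (simp add: turn_def)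

lemma turn_second_of_chord:
  assumes "pencil P = (1 + k\<^sup>2) * B" "pencil Q = (1 + k\<^sup>2) * B" "P \<noteq> Q"
    and "(Q - P) \<bullet> (F2 - P) = - (k * cross (Q - P) (F2 - P))"
  shows "turn k P F2 Q"
proof -
  \<comment> \<open>Reflection in the \<open>y\<close>-axis, which reduces the claim to the first focus.\<close>
  define m where "m = (\<lambda>P. (- fst P, snd P) :: point)"
  have "pencil (m R) = pencil R" for R by (simp add: m_def pencil_eq)
  moreover have "m P \<noteq> m Q" using assms(3) by (auto simp: m_def prod_eq_iff)
  moreover have inner: "(m Q - m P) \<bullet> (F1 - m P) = (F2 - P) \<bullet> (Q - P)"
    and cross: "cross (m Q - m P) (F1 - m P) = cross (F2 - P) (Q - P)"
    by (simp_all add: m_def cross_def inner_prod_def algebra_simps)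
  moreover have "(F2 - P) \<bullet> (Q - P) = k * cross (F2 - P) (Q - P)"
    using assms(4) by (simp add: inner_commute cross_commute[of "F2 - P"])
  ultimately have "turn k (m P) (m Q) F1"
    using assms by (intro turn_first_of_chord) simp_all
  then show ?thesis unfolding turn_def inner cross .
qed

text \<open>At each endpoint there are only two tangents to the ellipse. The side on which the foci lie decides which of
  them the chord is.\<close>

lemma tangent_chord_imp_turns:
  assumes P: "pencil P = (1 + k\<^sup>2) * B" and Q: "pencil Q = (1 + k\<^sup>2) * B" and ne: "P \<noteq> Q"
    and eq: "cross (Q - P) (F1 - P) * cross (Q - P) (F2 - P) = B * (norm (Q - P))\<^sup>2"
    and left: "0 < cross (Q - P) (F1 - P)" "0 < cross (Q - P) (F2 - P)"
  shows "turn k P Q F1" and "turn k Q F2 P"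
proof -
  have "(Q - P) \<bullet> (F1 - P) = k * cross (Q - P) (F1 - P) \<or> (Q - P) \<bullet> (F2 - P) = - (k * cross (Q - P) (F2 - P))"
    by (intro foci_mult_eq_imp_inner) (simp add: eq P)
  moreover have "\<not> turn k P F2 Q"
    using left by (simp add: turn_def cross_commute[of "F2 - P"])
  ultimately show "turn k P Q F1"
    using turn_first_of_chord[OF P Q ne] turn_second_of_chord[OF P Q ne] by blast
  have sw: "cross (P - Q) (F1 - Q) = - cross (Q - P) (F1 - P)"
    "cross (P - Q) (F2 - Q) = - cross (Q - P) (F2 - P)"
    by (simp_all add: cross_def algebra_simps)
  have "cross (P - Q) (F1 - Q) * cross (P - Q) (F2 - Q) = B * (norm (P - Q))\<^sup>2"
    unfolding sw using eq by (simp add: norm_minus_commute)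
  then have "(P - Q) \<bullet> (F1 - Q) = k * cross (P - Q) (F1 - Q) \<or> (P - Q) \<bullet> (F2 - Q) = - (k * cross (P - Q) (F2 - Q))"
    by (intro foci_mult_eq_imp_inner) (simp add: Q)
  moreover have "\<not> turn k Q P F1"
    using left by (simp add: turn_def sw)
  ultimately show "turn k Q F2 P"
    using turn_first_of_chord[OF Q P] turn_second_of_chord[OF Q P] ne by blast
qed

lemma poncelet_family_imp_turns:
  assumes "(P1, P2, P3) \<in> poncelet_family a b l"
  shows "turn k P1 P2 F1" "turn k P2 P3 F1" "turn k P3 P1 F1"
    and "turn k P2 F2 P1" "turn k P3 F2 P2" "turn k P1 F2 P3"
proof -
  have ccw: "ccw_triangle P1 P2 P3" "ccw_triangle P2 P3 P1" "ccw_triangle P3 P1 P2"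
    and circ: "circumscribes P1 P2 P3 E" "circumscribes P2 P3 P1 E" "circumscribes P3 P1 P2 E"
    and P: "pencil P1 = (1 + k\<^sup>2) * B" "pencil P2 = (1 + k\<^sup>2) * B" "pencil P3 = (1 + k\<^sup>2) * B"
    using assms unfolding poncelet_family_def mem_circle ccw_triangle_def circumscribes_def
    by (simp_all add: algebra_simps)
  have ne: "P1 \<noteq> P2" "P2 \<noteq> P3" "P3 \<noteq> P1"
    using ccw by (auto simp: ccw_triangle_def)
  show "turn k P1 P2 F1" "turn k P2 F2 P1"
    using tangent_chord_imp_turns[OF P(1,2) ne(1) circumscribes_imp_foci_left_of_side[OF ccw(1) circ(1)]] .
  show "turn k P2 P3 F1" "turn k P3 F2 P2"
    using tangent_chord_imp_turns[OF P(2,3) ne(2) circumscribes_imp_foci_left_of_side[OF ccw(2) circ(2)]] .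
  show "turn k P3 P1 F1" "turn k P1 F2 P3"
    using tangent_chord_imp_turns[OF P(3,1) ne(3) circumscribes_imp_foci_left_of_side[OF ccw(3) circ(3)]] .
qed

lemma poncelet_family_subset_brocard_triangles:
  "poncelet_family a b l \<subseteq> brocard_triangles F1 F2"
proof
  fix t assume t: "t \<in> poncelet_family a b l"
  obtain P1 P2 P3 where tP: "t = (P1, P2, P3)" by (cases t)
  have ccw: "ccw_triangle P1 P2 P3" using t by (simp add: tP poncelet_family_def)
  note turns = poncelet_family_imp_turns[OF t[unfolded tP]]
  have "k = brocard_cot P1 P2 P3"
    using turns_imp_brocard_cot[OF ccw turns(1-3)] .
  then show "t \<in> brocard_triangles F1 F2"
    using turns ccw unfolding tP brocard_triangles_def
    by (simp add: first_brocard_point_iff second_brocard_point_iff)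
qed

lemma turn_first_imp_tangent_chord:
  assumes "pencil P = (1 + k\<^sup>2) * B" and "turn k P Q F1"
  shows "cross (Q - P) (F1 - P) * cross (Q - P) (F2 - P) = B * (norm (Q - P))\<^sup>2"
proof -
  have "(1 + k\<^sup>2) * (cross (Q - P) (F1 - P) * cross (Q - P) (F2 - P)) = (1 + k\<^sup>2) * (B * (norm (Q - P))\<^sup>2)"
    using turn_first_imp_foci_mult[OF assms(2)] unfolding assms(1) by (simp only: ac_simps)
  then show ?thesis using one_plus_k_sq_pos by simp
qed

lemma turn_first_imp_side_tangent:
  assumes P: "pencil P = (1 + k\<^sup>2) * B" and Q: "pencil Q = (1 + k\<^sup>2) * B" and turn: "turn k P Q F1"
  shows "side_tangent P Q E"
proof -
  note eq = turn_first_imp_tangent_chord[OF P turn]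
  have ne: "P \<noteq> Q" and x: "0 < cross (Q - P) (F1 - P)"
    using turn by (auto simp: turn_def cross_def)
  have "0 < cross (Q - P) (F1 - P) * cross (Q - P) (F2 - P)"
    unfolding eq using B_pos ne by simp
  then have "0 < cross (Q - P) (F2 - P)" using x by (simp add: zero_less_mult_iff)
  then show ?thesis
    using turns_imp_side_tangent[OF turn tangent_chord_imp_turns(2)[OF P Q ne eq x] eq] by blast
qed

lemma turns_imp_poncelet_family:
  assumes P: "pencil P1 = (1 + k\<^sup>2) * B" "pencil P2 = (1 + k\<^sup>2) * B" "pencil P3 = (1 + k\<^sup>2) * B"
    and turns: "turn k P1 P2 F1" "turn k P2 P3 F1" "turn k P3 P1 F1"
  shows "(P1, P2, P3) \<in> poncelet_family a b l"
proof -
  have "ccw_triangle P1 P2 P3"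
    using turns unfolding ccw_iff_cross sum_inner_cross_first(2)[of P2 P1 F1 P3, symmetric] turn_def by linarith
  then show ?thesis
    using P turn_first_imp_side_tangent turns
    unfolding poncelet_family_def circumscribes_def by (simp add: mem_circle)
qed

lemma turn_first_imp_chord:
  assumes "pencil P = (1 + k\<^sup>2) * B" "pencil Q = (1 + k\<^sup>2) * B" and turn: "turn k P Q F1"
  shows "chord A (to_complex P) (to_complex Q)"
proof -
  have "P \<noteq> Q" using turn by (auto simp: turn_def cross_def)
  then show ?thesis
    using assms A_pos by (subst chord_iff) (simp_all add: turn_def A_eq distrib_left mult.commute)
qed

text \<open>The point \<open>Q\<close> is the second intersection of the circle with the line through \<open>P\<close> of direction \<open>e\<close>, which is
  the direction to \<open>F1\<close> turned clockwise.\<close>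

lemma ex_turn_first:
  assumes P: "pencil P = (1 + k\<^sup>2) * B"
  obtains Q where "pencil Q = (1 + k\<^sup>2) * B" and "turn k P Q F1"
proof -
  obtain x y where Pxy: "P = (x, y)" by (cases P)
  define f g where "f = - c - x" and "g = - y"
  define e where "e = (k * f + g, k * g - f)"
  define h where "h = x * fst e + (y + c * k) * snd e"
  \<comment> \<open>\<open>s\<close> is the nonzero root of the equation of the circle on the line \<open>P + s e\<close>; it is positive as \<open>h < 0\<close>.\<close>
  define s where "s = - 2 * h / ((fst e)\<^sup>2 + (snd e)\<^sup>2)"
  have circle: "x\<^sup>2 + (y + c * k)\<^sup>2 = (1 + k\<^sup>2) * A"
    using P unfolding pencil_eq Pxy by (simp add: A_eq power2_eq_square algebra_simps)
  have "h = - ((1 + k\<^sup>2) * (k * A - c * (y + c * k)))"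
    using circle unfolding h_def e_def f_def g_def fst_conv snd_conv by algebra
  moreover have "c * (y + c * k) < k * A"
    using circle_height_less[OF P] by (simp add: Pxy)
  ultimately have h: "h < 0" using one_plus_k_sq_pos by simp
  then have "fst e \<noteq> 0 \<or> snd e \<noteq> 0" by (auto simp: h_def)
  then have e: "0 < (fst e)\<^sup>2 + (snd e)\<^sup>2" by (simp add: sum_power2_gt_zero_iff)
  then have s: "0 < s" using h by (simp add: s_def divide_neg_pos)
  have s_eq: "s * ((fst e)\<^sup>2 + (snd e)\<^sup>2) = - 2 * h"
    unfolding s_def using e by (intro nonzero_divide_eq_eq[THEN iffD1, symmetric]) auto
  have fg: "f \<noteq> 0 \<or> g \<noteq> 0" using e by (auto simp: e_def)
  show ?thesis
  proof (rule that)
    show "pencil (P + s *\<^sub>R e) = (1 + k\<^sup>2) * B"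
    proof -
      have "pencil (P + s *\<^sub>R e) = pencil P + s * (s * ((fst e)\<^sup>2 + (snd e)\<^sup>2) + 2 * h)"
        by (simp add: pencil_eq h_def Pxy power2_eq_square algebra_simps)
      then show ?thesis by (simp add: s_eq P)
    qed
    have "cross (s *\<^sub>R e) (F1 - P) = s * (f\<^sup>2 + g\<^sup>2)" "(s *\<^sub>R e) \<bullet> (F1 - P) = k * (s * (f\<^sup>2 + g\<^sup>2))"
      unfolding Pxy by (simp_all add: cross_def inner_prod_def e_def f_def g_def power2_eq_square algebra_simps)
    then show "turn k P (P + s *\<^sub>R e) F1"
      using s fg by (simp add: turn_def sum_power2_gt_zero_iff)
  qed
qed

lemma closure_defect: "A * (k\<^sup>2 - 3) = c\<^sup>2 * (1 + k\<^sup>2)"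
  using closure unfolding A_eq by algebra

text \<open>The construction of the second and the third vertex by successive chords closes up because the
  parameters satisfy the closure condition; uniqueness holds because the Moebius transformation and its inverse are
  single-valued on the circle.\<close>

lemma ex1_poncelet_triangle:
  assumes "P1 \<in> circ_circle a b l"
  shows "\<exists>!(P2, P3). (P1, P2, P3) \<in> poncelet_family a b l"
proof -
  have P1: "pencil P1 = (1 + k\<^sup>2) * B" using assms by (simp add: mem_circle)
  obtain P2 where P2: "pencil P2 = (1 + k\<^sup>2) * B" and t12: "turn k P1 P2 F1"
    using ex_turn_first[OF P1] .
  obtain P3 where P3: "pencil P3 = (1 + k\<^sup>2) * B" and t23: "turn k P2 P3 F1"
    using ex_turn_first[OF P2] .
  note c12 = turn_first_imp_chord[OF P1 P2 t12] and c23 = turn_first_imp_chord[OF P2 P3 t23]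
  have "2 * \<i> * of_real A \<noteq> 0" using A_pos by simp
  then have c31: "chord A (to_complex P3) (to_complex P1)"
    using chord_chord_imp[OF c12 c23] unfolding closure_defect chord_def[of A "to_complex P3"] by simp
  have "P3 \<noteq> P1"
  proof
    assume "P3 = P1"
    then have "to_complex P1 = to_complex P2"
      using chord_not_symmetric[OF _ c12] c23 A_pos by simp
    then show False using t12 by (simp add: inj_to_complex turn_def cross_def)
  qed
  then have t31: "turn k P3 P1 F1"
    using c31 P1 P3 A_pos by (intro turn_first_of_chord, simp_all, subst chord_iff[symmetric])
      (simp_all add: A_eq distrib_left mult.commute)
  have mem: "(P1, P2, P3) \<in> poncelet_family a b l"
    using turns_imp_poncelet_family[OF P1 P2 P3 t12 t23 t31] .
  have uniq: "Q2 = P2 \<and> Q3 = P3" if Q: "(P1, Q2, Q3) \<in> poncelet_family a b l" for Q2 Q3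
  proof -
    have Q2: "pencil Q2 = (1 + k\<^sup>2) * B" and Q3: "pencil Q3 = (1 + k\<^sup>2) * B"
      using Q by (auto simp: poncelet_family_def mem_circle)
    have p1: "(cmod (to_complex P1))\<^sup>2 = (1 + k\<^sup>2) * A"
      by (simp add: norm_to_complex P1 A_eq algebra_simps)
    have "to_complex Q2 = to_complex P2"
      using chord_unique_right[OF c_sq_less_A p1
          turn_first_imp_chord[OF P1 Q2 poncelet_family_imp_turns(1)[OF Q]] c12] .
    moreover have "to_complex Q3 = to_complex P3"
      using chord_unique_left[OF c_sq_less_A p1
          turn_first_imp_chord[OF Q3 P1 poncelet_family_imp_turns(3)[OF Q]] c31] .
    ultimately show ?thesis by (simp add: inj_to_complex)
  qed
  show ?thesis
  proof (rule ex1I[of _ "(P2, P3)"])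
    show "case (P2, P3) of (P2, P3) \<Rightarrow> (P1, P2, P3) \<in> poncelet_family a b l"
      using mem by simp
    fix q assume "case q of (P2, P3) \<Rightarrow> (P1, P2, P3) \<in> poncelet_family a b l"
    then have "(P1, fst q, snd q) \<in> poncelet_family a b l" by (simp add: case_prod_unfold)
    from uniq[OF this] show "q = (P2, P3)" by (simp add: prod_eq_iff)
  qed
qed

end

lemma confocal_ellipse_parametersI:
  assumes "0 < b" "b < a" "c = sqrt (a\<^sup>2 - b\<^sup>2)" "l < b\<^sup>2"
  shows "confocal_ellipse_parameters c a b l (a\<^sup>2 - l) (b\<^sup>2 - l)"
proof -
  have "b\<^sup>2 < a\<^sup>2" using assms by (simp add: power_strict_mono)
  then show ?thesis using assms by unfold_locales simp_all
qed

text \<open>The value of \<open>k\<close> is forced by the closure condition.\<close>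

lemma brocard_porismI:
  assumes "confocal_ellipse_parameters c a b l A B"
  shows "brocard_porism c a b l A B (sqrt ((4 * A - B) / B))"
proof -
  interpret confocal_ellipse_parameters c a b l A B by fact
  have "0 < (4 * A - B) / B" using A_pos B_pos A_eq zero_le_power2[of c]
    by (intro divide_pos_pos) linarith+
  then show ?thesis using B_pos by unfold_locales (simp_all add: field_simps)
qed

text \<open>Both sides through a vertex give the same product of focal distances, namely \<open>pencil / (1 + k\<^sup>2)\<close> at that
  vertex, and each side has only one such product. Hence the three products agree, their common value is \<open>B\<close>, and
  the vertices lie on one circle of the pencil. As the triangle closes after three chords, the closure
  condition follows.\<close>

lemma (in focal_pencil) turns_imp_brocard_porism:
  assumes turns: "turn k P1 P2 F1" "turn k P2 P3 F1" "turn k P3 P1 F1"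
    "turn k P2 F2 P1" "turn k P3 F2 P2" "turn k P1 F2 P3"
    and ab: "a\<^sup>2 - b\<^sup>2 = c\<^sup>2"
  obtains A B where "brocard_porism c a b (b\<^sup>2 - B) A B k"
    "pencil P1 = (1 + k\<^sup>2) * B" "pencil P2 = (1 + k\<^sup>2) * B" "pencil P3 = (1 + k\<^sup>2) * B"
proof -
  have ne: "P1 \<noteq> P2" "P2 \<noteq> P3" "P3 \<noteq> P1" using turns by (auto simp: turn_def cross_def)
  have pos: "0 < 1 + k\<^sup>2" by (simp add: add_pos_nonneg)
  have "(norm (P2 - P1))\<^sup>2 * pencil P1 = (norm (P2 - P1))\<^sup>2 * pencil P2"
    by (rule trans[OF turn_first_imp_foci_mult[OF turns(1), symmetric] turn_second_imp_foci_mult[OF turns(4)]])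
  then have p12: "pencil P2 = pencil P1" using ne by simp
  have "(norm (P3 - P2))\<^sup>2 * pencil P2 = (norm (P3 - P2))\<^sup>2 * pencil P3"
    by (rule trans[OF turn_first_imp_foci_mult[OF turns(2), symmetric] turn_second_imp_foci_mult[OF turns(5)]])
  then have p23: "pencil P3 = pencil P1" using ne p12 by simp
  define B A where "B = pencil P1 / (1 + k\<^sup>2)" and "A = B + c\<^sup>2"
  have P: "pencil P1 = (1 + k\<^sup>2) * B" "pencil P2 = (1 + k\<^sup>2) * B" "pencil P3 = (1 + k\<^sup>2) * B"
    using pos by (simp_all add: B_def p12 p23)
  have "cross (F2 - P2) (P1 - P2) = cross (P2 - P1) (F2 - P1)"
    by (simp add: cross_def algebra_simps)
  then have "0 < (1 + k\<^sup>2) * (cross (P2 - P1) (F1 - P1) * cross (P2 - P1) (F2 - P1))"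
    using turns(1,4) pos by (simp add: turn_def)
  then have "0 < (norm (P2 - P1))\<^sup>2 * pencil P1"
    unfolding turn_first_imp_foci_mult[OF turns(1)] .
  then have B: "0 < B" using ne pos unfolding P by (simp add: zero_less_mult_iff)
  have A: "0 < A" using B by (simp add: A_def add_pos_nonneg)
  have chord: "chord A (to_complex P) (to_complex Q)"
    if "pencil P = (1 + k\<^sup>2) * B" "pencil Q = (1 + k\<^sup>2) * B" "P \<noteq> Q" "turn k P Q F1" for P Q
    using that A by (subst chord_iff) (simp_all add: turn_def A_def distrib_left mult.commute)
  have "(to_complex P1 - to_complex P3) * of_real (A * (A * (k\<^sup>2 - 3) - c\<^sup>2 * (1 + k\<^sup>2))) = 0"
    using chord_chord_imp[OF chord[OF P(1,2) ne(1) turns(1)] chord[OF P(2,3) ne(2) turns(2)]]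
      chord[OF P(3,1) ne(3) turns(3)] unfolding chord_def by simp
  then have "A * (k\<^sup>2 - 3) - c\<^sup>2 * (1 + k\<^sup>2) = 0"
    using ne(3) A by (simp add: inj_to_complex del: of_real_mult of_real_diff)
  then have "(1 + k\<^sup>2) * B = 4 * A" unfolding A_def by algebra
  then have "brocard_porism c a b (b\<^sup>2 - B) A B k"
    using B ab by unfold_locales (simp_all add: A_def)
  then show ?thesis using that P by blast
qed

theorem theorem2:
  fixes a b c :: real
  assumes "0 < b" and "b < a" and "c = sqrt (a\<^sup>2 - b\<^sup>2)"
  shows
    "(\<forall>l < b\<^sup>2.
        poncelet_family a b l \<subseteq> brocard_triangles (- c, 0) (c, 0) \<and>
        (\<forall>P1 \<in> circ_circle a b l. \<exists>!(P2, P3). (P1, P2, P3) \<in> poncelet_family a b l)) \<and>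
     (\<forall>t \<in> brocard_triangles (- c, 0) (c, 0). \<exists>!l. l < b\<^sup>2 \<and> t \<in> poncelet_family a b l)"
proof (intro conjI allI impI ballI)
  fix l assume l: "l < b\<^sup>2"
  interpret brocard_porism c a b l "a\<^sup>2 - l" "b\<^sup>2 - l" "sqrt ((4 * (a\<^sup>2 - l) - (b\<^sup>2 - l)) / (b\<^sup>2 - l))"
    by (intro brocard_porismI confocal_ellipse_parametersI assms l)
  show "poncelet_family a b l \<subseteq> brocard_triangles (- c, 0) (c, 0)"
    by (rule poncelet_family_subset_brocard_triangles)
  show "\<exists>!(P2, P3). (P1, P2, P3) \<in> poncelet_family a b l" if "P1 \<in> circ_circle a b l" for P1
    using that by (rule ex1_poncelet_triangle)
next
  fix t assume t: "t \<in> brocard_triangles (- c, 0) (c, 0)"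
  obtain P1 P2 P3 where tP: "t = (P1, P2, P3)" by (cases t)
  have ccw: "ccw_triangle P1 P2 P3" using t by (simp add: tP brocard_triangles_def)
  define k where "k = brocard_cot P1 P2 P3"
  have ab: "b\<^sup>2 < a\<^sup>2" using assms by (simp add: power_strict_mono)
  then have c: "0 < c" "a\<^sup>2 - b\<^sup>2 = c\<^sup>2" using assms by simp_all
  interpret focal_pencil c k
    using c brocard_cot_pos[OF ccw] by unfold_locales (simp_all add: k_def)
  have turns: "turn k P1 P2 F1" "turn k P2 P3 F1" "turn k P3 P1 F1"
    "turn k P2 F2 P1" "turn k P3 F2 P2" "turn k P1 F2 P3"
    using t ccw unfolding tP brocard_triangles_def k_def
    by (simp_all add: first_brocard_point_iff second_brocard_point_iff Let_def)
  obtain A B where "brocard_porism c a b (b\<^sup>2 - B) A B k"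
    and P: "pencil P1 = (1 + k\<^sup>2) * B" "pencil P2 = (1 + k\<^sup>2) * B" "pencil P3 = (1 + k\<^sup>2) * B"
    using turns_imp_brocard_porism[OF turns c(2)] .
  then interpret brocard_porism c a b "b\<^sup>2 - B" A B k by blast
  show "\<exists>!l. l < b\<^sup>2 \<and> t \<in> poncelet_family a b l"
  proof (rule ex1I[of _ "b\<^sup>2 - B"], intro conjI)
    show "b\<^sup>2 - B < b\<^sup>2" using B_pos by simp
    show "t \<in> poncelet_family a b (b\<^sup>2 - B)"
      unfolding tP using turns_imp_poncelet_family[OF P turns(1-3)] .
    \<comment> \<open>The product of the focal distances of one side already determines \<open>l\<close>.\<close>
    fix l assume l: "l < b\<^sup>2 \<and> t \<in> poncelet_family a b l"
    interpret l: confocal_ellipse_parameters c a b l "a\<^sup>2 - l" "b\<^sup>2 - l"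
      using l by (intro confocal_ellipse_parametersI assms) simp
    have "circumscribes P1 P2 P3 (confocal_ellipse a b l)"
      using l by (simp add: tP poncelet_family_def)
    then have "(b\<^sup>2 - l) * (norm (P2 - P1))\<^sup>2 = B * (norm (P2 - P1))\<^sup>2"
      by (rule trans[OF l.circumscribes_imp_foci_left_of_side(1)[OF ccw, symmetric]
            turn_first_imp_tangent_chord[OF P(1) turns(1)]])
    moreover have "P2 \<noteq> P1" using ccw by (auto simp: ccw_triangle_def)
    ultimately show "l = b\<^sup>2 - B" by simp
  qed
qed

end
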